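(* Let $n\ge 2$, let $\lambda=(\lambda_1,\dots,\lambda_n)\in\mathbb{R}^n$ satisfy $1>\lambda_1>\lambda_2>\cdots>\lambda_n$ and $\lambda_1>\max_{2\le \ell\le n}|\lambda_\ell|$, and let $\beta=(\beta_1,\dots,\beta_n)\in\mathbb{R}^n$ satisfy $\sum_{\ell=1}^n\beta_\ell=1$ and $\prod_{\ell=1}^n\beta_\ell\ne 0$. For $A\in\mathbb{R}^{n\times n}$ let $B$ be the $n^2\times(n^2+n)$ matrix whose transpose is $$B^\top=\begin{bmatrix} A^\top-\lambda_1 I& & & \\ & A^\top-\lambda_2 I& & \\ & &\ddots& \\ & & & A^\top-\lambda_n I\\ \beta_1 I&\beta_2 I&\cdots&\beta_n I\end{bmatrix}.$$ Then, for every entrywise nonnegative $A\in\mathbb{R}^{n\times n}$ all of whose row sums are at most $1$, $$\det(BB^\top)\ \ge\ 2^{-n(n-2)}\left(\frac{\sum_{i\neq j}\gamma_i^{(n-1)}\gamma_j^{(n-1)}\big(\lambda_{[n+i-1]_n}-\lambda_{[n+j-1]_n}\big)^2}{\sum_{i=1}^n\gamma_i^{(n-1)}}\right)^n,$$ where the numbers $\gamma_i^{(k)}$ and the notation $[\cdot]_n$ are defined in the context.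
   Context: $I$ is the $n\times n$ identity matrix; blank blocks are zero. The indices $i,j$ in the sums range over $\{1,\dots,n\}$. For a positive integer $\ell$, $[\ell]_n\in\{1,\dots,n\}$ is the representative of $\ell$ modulo $n$: $[\ell]_n=\ell \bmod n$ if this is nonzero, and $[\ell]_n=n$ otherwise. The numbers $\gamma_i^{(k)}$ ($1\le i\le n$, $1\le k\le n-1$) are defined recursively by $$\gamma_i^{(1)}=\beta_i^2,\quad 1\le i\le n,$$ $$\gamma_i^{(k+1)}=\frac{\gamma_i^{(k)}\,\gamma_{[i+1]_n}^{(k)}\,(\lambda_i-\lambda_{[i+k]_n})^2}{\gamma_i^{(k)}+\gamma_{[i+1]_n}^{(k)}},\quad 1\le i\le n,\ 1\le k\le n-2 .$$ All $\gamma_i^{(k)}$ are positive.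
   Formalization: The sum over i≠j is taken over unordered pairs (each pair counted once); with ordered pairs the bound is false, e.g. n=2, λ=(3/5,2/5), β=(1/2,1/2), A=I/2 gives det(BB^T)=0.0051² but a right-hand side of 0.01². *)

theory Defs
  imports "Jordan_Normal_Form.Determinant"
begin

text \<open>
  Vectors of length \<open>n\<close> are functions on \<open>{1..n}\<close> (type \<open>nat \<Rightarrow> real\<close>, values outside
  \<open>{1..n}\<close> are never used), so indices agree with the cyclic representatives in \<open>{1..n}\<close>.
  Matrix entries are indexed from 0.
\<close>

definition cyc :: "nat \<Rightarrow> nat \<Rightarrow> nat" where
  "cyc n l = (if l mod n = 0 then n else l mod n)"

text \<open>The superscript comes before the index and starts at 1; the value at 0 is a dummy.\<close>

fun gam :: "nat \<Rightarrow> (nat \<Rightarrow> real) \<Rightarrow> (nat \<Rightarrow> real) \<Rightarrow> nat \<Rightarrow> nat \<Rightarrow> real" where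
  "gam n lam bet 0 i = 0"
| "gam n lam bet (Suc 0) i = (bet i)\<^sup>2"
| "gam n lam bet (Suc (Suc k)) i =
     gam n lam bet (Suc k) i * gam n lam bet (Suc k) (cyc n (i + 1))
       * (lam i - lam (cyc n (i + Suc k)))\<^sup>2
     / (gam n lam bet (Suc k) i + gam n lam bet (Suc k) (cyc n (i + 1)))"

text \<open>Block \<open>(p, q)\<close> of the transpose of \<open>B\<close>, for \<open>1 \<le> p \<le> n + 1\<close> and \<open>1 \<le> q \<le> n\<close>.\<close>

definition Bt_block ::
    "nat \<Rightarrow> (nat \<Rightarrow> real) \<Rightarrow> (nat \<Rightarrow> real) \<Rightarrow> real mat \<Rightarrow> nat \<Rightarrow> nat \<Rightarrow> real mat" where
  "Bt_block n lam bet A p q =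
     (if p = n + 1 then bet q \<cdot>\<^sub>m 1\<^sub>m n
      else if p = q then transpose_mat A - lam p \<cdot>\<^sub>m 1\<^sub>m n
      else 0\<^sub>m n n)"

definition Bt_mat :: "nat \<Rightarrow> (nat \<Rightarrow> real) \<Rightarrow> (nat \<Rightarrow> real) \<Rightarrow> real mat \<Rightarrow> real mat" where
  "Bt_mat n lam bet A =
     mat (n\<^sup>2 + n) (n\<^sup>2)
       (\<lambda>(r, c). Bt_block n lam bet A (r div n + 1) (c div n + 1) $$ (r mod n, c mod n))"

definition B_mat :: "nat \<Rightarrow> (nat \<Rightarrow> real) \<Rightarrow> (nat \<Rightarrow> real) \<Rightarrow> real mat \<Rightarrow> real mat" where
  "B_mat n lam bet A = transpose_mat (Bt_mat n lam bet A)"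

text \<open>
  The sum over \<open>i \<noteq> j\<close> in the lower bound counts each unordered pair once. Counting
  ordered pairs would double the sum, and the bound would be false: take \<open>n = 2\<close>,
  \<open>lam = (3/5, 2/5)\<close>, \<open>bet = (1/2, 1/2)\<close> and \<open>A\<close> equal to half the identity; then the
  determinant is \<open>0.0051\<^sup>2\<close>, whereas the bound is \<open>0.005\<^sup>2\<close> for unordered pairs and
  \<open>0.01\<^sup>2\<close> for ordered pairs.
\<close>

definition idx_pairs :: "nat \<Rightarrow> (nat \<times> nat) set" where
  "idx_pairs n = {(i, j). i \<in> {1..n} \<and> j \<in> {1..n} \<and> i < j}"

end

theory Submission
  imports Defs "Jordan_Normal_Form.Char_Poly"
begin

text \<open>
  Put \<open>M\<^sub>i = A - \<lambda>\<^sub>i I\<close> (indices cyclic), \<open>P = \<Prod>\<^sub>i M\<^sub>i\<close> and \<open>N\<^sub>q = \<Prod>\<^sub>i\<^sub>\<noteq>\<^sub>q M\<^sub>i\<close>. The orthogonal complement of the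
  row space of \<open>B\<close> is spanned by the columns of the matrix with blocks \<open>-\<beta>\<^sub>q N\<^sub>q\<close> and \<open>P\<close>; if \<open>P\<close> is
  invertible, this gives \<open>det (B B\<^sup>T) = det S\<close> with \<open>S = P\<^sup>T P + \<Sum>\<^sub>q \<beta>\<^sub>q\<^sup>2 N\<^sub>q\<^sup>T N\<^sub>q\<close>.
  In every coordinate, \<open>a b / (a + b) (x - y)\<^sup>2 \<le> a x\<^sup>2 + b y\<^sup>2\<close> is applied to cyclically adjacent terms
  of \<open>\<Sum>\<^sub>q \<beta>\<^sub>q\<^sup>2 |N\<^sub>q u|\<^sup>2\<close>, whose products differ in one factor only. Each round removes one factor
  and costs a factor 2, and the weights follow the recursion of the \<open>\<gamma>\<close>. After \<open>n - 2\<close> rounds there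
  remains \<open>\<Sum>\<^sub>i \<gamma>\<^sub>i |M\<^sub>i\<^sub>+\<^sub>n\<^sub>-\<^sub>1 u|\<^sup>2\<close>, which the Lagrange identity bounds below by a multiple of
  \<open>|u|\<^sup>2\<close>. So all eigenvalues of \<open>S\<close> are at least the base of the \<open>n\<close>-th power in the bound. As the
  bound does not depend on \<open>A\<close>, singular \<open>P\<close> follows by continuity.
\<close>

section \<open>Weighted sums of squares\<close>

text \<open>Multiplied by \<open>a + b\<close>, the right side exceeds the left by the square of
  \<open>a * x + b * y\<close>. If \<open>a + b = 0\<close>, the quotient is 0 by
  convention.\<close>

lemma weighted_square_diff_le:
  fixes a b x y :: real
  assumes "a \<ge> 0" "b \<ge> 0"
  shows "a * b / (a + b) * (x - y)\<^sup>2 \<le> a * x\<^sup>2 + b * y\<^sup>2"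
proof (cases "a + b = 0")
  case False
  with assms have pos: "a + b > 0" by simp
  have "(a * x\<^sup>2 + b * y\<^sup>2) * (a + b) - a * b * (x - y)\<^sup>2 = (a * x + b * y)\<^sup>2"
    by (simp add: power2_eq_square algebra_simps)
  then have "a * b * (x - y)\<^sup>2 \<le> (a * x\<^sup>2 + b * y\<^sup>2) * (a + b)"
    using zero_le_power2[of "a * x + b * y"] by linarith
  then show ?thesis using pos by (simp add: field_simps)
qed (use assms in simp)

lemma sum_idx_pairs:
  fixes f :: "nat \<Rightarrow> nat \<Rightarrow> real"
  assumes sym: "\<And>i j. f i j = f j i" and diag: "\<And>i. f i i = 0"
  shows "(\<Sum>i=1..n. \<Sum>j=1..n. f i j) = 2 * (\<Sum>(i, j)\<in>idx_pairs n. f i j)"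
proof -
  let ?S = "{1..n} \<times> {1..n}"
  let ?L = "{(i, j). i \<in> {1..n} \<and> j \<in> {1..n} \<and> j < i}"
  let ?D = "{(i, j). i \<in> {1..n} \<and> j \<in> {1..n} \<and> i = j}"
  have fin: "finite (idx_pairs n)" "finite ?L" "finite ?D"
    by (rule finite_subset[of _ ?S]; force simp: idx_pairs_def)+
  have S: "?S = (idx_pairs n \<union> ?L) \<union> ?D"
    by (auto simp: idx_pairs_def)
  have "(\<Sum>i=1..n. \<Sum>j=1..n. f i j) = (\<Sum>(i, j)\<in>?S. f i j)"
    by (simp add: sum.cartesian_product)
  also have "\<dots> = (\<Sum>(i, j)\<in>idx_pairs n. f i j) + (\<Sum>(i, j)\<in>?L. f i j) + (\<Sum>(i, j)\<in>?D. f i j)"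
    unfolding S using fin
    by (subst sum.union_disjoint, auto simp: idx_pairs_def intro!: sum.union_disjoint)
  also have "(\<Sum>(i, j)\<in>?D. f i j) = 0"
    by (rule sum.neutral) (auto simp: diag)
  also have "(\<Sum>(i, j)\<in>?L. f i j) = (\<Sum>(i, j)\<in>idx_pairs n. f i j)"
    by (rule sum.reindex_bij_witness[of _ "\<lambda>(i, j). (j, i)" "\<lambda>(i, j). (j, i)"])
      (auto simp: idx_pairs_def sym)
  finally show ?thesis by simp
qed

text \<open>The pair sum is half the double sum over all \<open>i\<close> and \<open>j\<close>,
  where the expanded square separates into products of single sums.\<close>

lemma weighted_lagrange_identity:
  fixes g y :: "nat \<Rightarrow> real"
  shows "(\<Sum>i=1..n. g i) * (\<Sum>i=1..n. g i * (y i)\<^sup>2) =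
    (\<Sum>i=1..n. g i * y i)\<^sup>2 + (\<Sum>(i, j)\<in>idx_pairs n. g i * g j * (y i - y j)\<^sup>2)"
proof -
  let ?G = "\<Sum>i=1..n. g i" and ?T = "\<Sum>i=1..n. g i * (y i)\<^sup>2" and ?Y = "\<Sum>i=1..n. g i * y i"
  have "2 * (\<Sum>(i, j)\<in>idx_pairs n. g i * g j * (y i - y j)\<^sup>2)
      = (\<Sum>i=1..n. \<Sum>j=1..n. g i * g j * (y i - y j)\<^sup>2)"
    by (rule sum_idx_pairs[symmetric]) (auto simp: power2_commute mult.commute)
  also have "\<dots> = (\<Sum>i=1..n. \<Sum>j=1..n. g i * (y i)\<^sup>2 * g j + g i * (g j * (y j)\<^sup>2)
      - 2 * ((g i * y i) * (g j * y j)))"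
    by (intro sum.cong refl) (simp add: power2_eq_square algebra_simps)
  also have "\<dots> = ?T * ?G + ?G * ?T - 2 * (?Y * ?Y)"
    by (simp only: sum.distrib sum_subtractf sum_distrib_left[symmetric] sum_distrib_right[symmetric])
  finally show ?thesis by (simp add: power2_eq_square algebra_simps)
qed

text \<open>The differences of the \<open>a - m i * b\<close> do not contain \<open>a\<close>, so
  the Lagrange identity gives a bound uniform in \<open>a\<close> once the square of the weighted
  sum is dropped.\<close>

lemma weighted_square_distance_ge:
  fixes g m :: "nat \<Rightarrow> real" and a b :: real
  assumes "\<And>i. i \<in> {1..n} \<Longrightarrow> g i \<ge> 0"
  shows "(\<Sum>(i, j)\<in>idx_pairs n. g i * g j * (m i - m j)\<^sup>2) / (\<Sum>i=1..n. g i) * b\<^sup>2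
    \<le> (\<Sum>i=1..n. g i * (a - m i * b)\<^sup>2)"
proof (cases "(\<Sum>i=1..n. g i) = 0")
  case True
  then show ?thesis using assms by (auto intro!: sum_nonneg mult_nonneg_nonneg)
next
  case False
  let ?G = "\<Sum>i=1..n. g i" and ?E = "\<Sum>(i, j)\<in>idx_pairs n. g i * g j * (m i - m j)\<^sup>2"
  let ?T = "\<Sum>i=1..n. g i * (a - m i * b)\<^sup>2"
  have "?G \<ge> 0" using assms by (auto intro!: sum_nonneg)
  with False have pos: "?G > 0" by linarith
  have "(\<Sum>(i, j)\<in>idx_pairs n. g i * g j * ((a - m i * b) - (a - m j * b))\<^sup>2) = ?E * b\<^sup>2"
    unfolding sum_distrib_right
    by (intro sum.cong refl) (auto simp: power2_eq_square algebra_simps)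
  with weighted_lagrange_identity[of g n "\<lambda>i. a - m i * b"]
  have "?E * b\<^sup>2 \<le> ?G * ?T" by simp
  then show ?thesis using pos by (simp add: field_simps)
qed

section \<open>Cyclic indices and the recursion of the weights\<close>

lemma cyc_self: "i \<in> {1..n} \<Longrightarrow> cyc n i = i"
  by (cases "i = n") (auto simp: cyc_def)

lemma cyc_add_period: "cyc n (i + n) = cyc n i"
  by (simp add: cyc_def)

lemma sum_cyc_shift:
  fixes f :: "nat \<Rightarrow> real"
  assumes "n > 0"
  shows "(\<Sum>i=1..n. f (cyc n (i + 1))) = (\<Sum>i=1..n. f i)"
proof -
  obtain m where n: "n = Suc m" using assms by (cases n) auto
  have "(\<Sum>i=1..n. f (cyc n (i + 1))) = (\<Sum>i=1..m. f (cyc n (i + 1))) + f (cyc n (n + 1))"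
    by (simp add: n)
  also have "(\<Sum>i=1..m. f (cyc n (i + 1))) = (\<Sum>i=1..m. f (i + 1))"
    by (intro sum.cong refl) (subst cyc_self, auto simp: n)
  also have "cyc n (n + 1) = 1"
    using cyc_add_period[of n 1] cyc_self[of 1 n] assms by (simp add: add.commute)
  also have "(\<Sum>i=1..m. f (i + 1)) + f 1 = (\<Sum>i=1..n. f i)"
    using sum.atLeast_Suc_atMost[of 1 n f] sum.shift_bounds_cl_Suc_ivl[of f 1 m]
    by (simp only: n Suc_eq_plus1)
  finally show ?thesis .
qed

lemma gam_nonneg: "gam n lam bet k i \<ge> 0"
  by (induction n lam bet k i rule: gam.induct)
    (simp_all del: One_nat_def add_2_eq_Suc' add: divide_nonneg_nonneg)

text \<open>\<open>z i m\<close> stands for a product of \<open>m\<close> cyclically consecutive commuting factors, starting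
  with the \<open>i\<close>-th one; \<open>diff\<close> compares two such products that share all factors but one.\<close>

lemma gam_sum_step:
  fixes z :: "nat \<Rightarrow> nat \<Rightarrow> real"
  assumes n: "n > 0" and k: "1 \<le> k" "k < n"
    and periodic: "\<And>i m. z (i + n) m = z i m"
    and diff: "\<And>i. i \<in> {1..n} \<Longrightarrow>
      z (i + k) (n - k) - z (i + 1 + k) (n - k) = (lam i - lam (cyc n (i + k))) * z (i + Suc k) (n - Suc k)"
  shows "(\<Sum>i=1..n. gam n lam bet (Suc k) i * (z (i + Suc k) (n - Suc k))\<^sup>2)
    \<le> 2 * (\<Sum>i=1..n. gam n lam bet k i * (z (i + k) (n - k))\<^sup>2)"
proof -
  let ?g = "gam n lam bet k"
  let ?f = "\<lambda>i. ?g i * (z (i + k) (n - k))\<^sup>2"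
  \<comment> \<open>The recursive equation of \<open>gam\<close> is stated for
    \<open>Suc (Suc l)\<close>.\<close>
  obtain l where l: "k = Suc l" using k by (cases k) auto
  \<comment> \<open>For \<open>i = n\<close> the successor \<open>n + 1\<close> is sent to 1 by
    \<open>cyc\<close>; the period of \<open>z\<close> absorbs the difference.\<close>
  have shift: "z (i + 1 + k) (n - k) = z (cyc n (i + 1) + k) (n - k)" if "i \<in> {1..n}" for i
  proof (cases "i = n")
    case True
    have "cyc n (n + 1) = 1"
      using cyc_add_period[of n 1] cyc_self[of 1 n] n by (simp add: add.commute)
    then show ?thesis using True periodic[of "1 + k" "n - k"] by (simp add: ac_simps)
  next
    case False
    then show ?thesis using that by (subst cyc_self) auto
  qed
  have "gam n lam bet (Suc k) i * (z (i + Suc k) (n - Suc k))\<^sup>2 \<le> ?f i + ?f (cyc n (i + 1))"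
    if i: "i \<in> {1..n}" for i
  proof -
    have "gam n lam bet (Suc k) i * (z (i + Suc k) (n - Suc k))\<^sup>2
        = ?g i * ?g (cyc n (i + 1)) / (?g i + ?g (cyc n (i + 1)))
          * ((lam i - lam (cyc n (i + k))) * z (i + Suc k) (n - Suc k))\<^sup>2"
      unfolding l by (simp add: power_mult_distrib)
    also have "\<dots> \<le> ?g i * (z (i + k) (n - k))\<^sup>2 + ?g (cyc n (i + 1)) * (z (i + 1 + k) (n - k))\<^sup>2"
      unfolding diff[OF i, symmetric] by (rule weighted_square_diff_le) (rule gam_nonneg)+
    finally show ?thesis unfolding shift[OF i] .
  qed
  then have "(\<Sum>i=1..n. gam n lam bet (Suc k) i * (z (i + Suc k) (n - Suc k))\<^sup>2)
      \<le> (\<Sum>i=1..n. ?f i + ?f (cyc n (i + 1)))"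
    by (intro sum_mono) auto
  \<comment> \<open>Every term occurs once as itself and once as a cyclic neighbour, whence the
    factor 2.\<close>
  also have "\<dots> = 2 * (\<Sum>i=1..n. ?f i)"
    unfolding sum.distrib sum_cyc_shift[OF n, of ?f] by simp
  finally show ?thesis .
qed

text \<open>Each of \<open>k\<close> rounds of the previous inequality costs a factor 2. The start
  has weights \<open>(bet i)\<^sup>2\<close> on products of \<open>n - 1\<close> factors; at
  \<open>k = n - 2\<close> single factors are left.\<close>

lemma gam_sum_ge:
  fixes z :: "nat \<Rightarrow> nat \<Rightarrow> real"
  assumes periodic: "\<And>i m. z (i + n) m = z i m"
    and diff: "\<And>i k. i \<in> {1..n} \<Longrightarrow> 1 \<le> k \<Longrightarrow> k < n \<Longrightarrow>
      z (i + k) (n - k) - z (i + 1 + k) (n - k) = (lam i - lam (cyc n (i + k))) * z (i + Suc k) (n - Suc k)"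
    and k: "k < n - 1"
  shows "(\<Sum>i=1..n. gam n lam bet (Suc k) i * (z (i + Suc k) (n - Suc k))\<^sup>2)
    \<le> 2 ^ k * (\<Sum>i=1..n. (bet i)\<^sup>2 * (z (i + 1) (n - 1))\<^sup>2)"
  using k
proof (induction k)
  case (Suc k)
  have "(\<Sum>i=1..n. gam n lam bet (Suc (Suc k)) i * (z (i + Suc (Suc k)) (n - Suc (Suc k)))\<^sup>2)
    \<le> 2 * (\<Sum>i=1..n. gam n lam bet (Suc k) i * (z (i + Suc k) (n - Suc k))\<^sup>2)"
    using Suc.prems by (intro gam_sum_step periodic diff) auto
  with Suc show ?case by simp
qed simp

section \<open>Lower bound for the determinant of a symmetric matrix\<close>

text \<open>With \<open>x\<close> and \<open>y\<close> the real and imaginary parts of an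
  eigenvector, symmetry of the bilinear form forces \<open>Im e = 0\<close>; the sum of the
  quadratic forms at \<open>x\<close> and \<open>y\<close> is then \<open>Re e\<close> times a
  positive number.\<close>

lemma eigenvalue_of_real_symmetric:
  fixes S :: "real mat"
  assumes S: "S \<in> carrier_mat n n" and sym: "transpose_mat S = S"
    and ge: "\<And>u. u \<in> carrier_vec n \<Longrightarrow> c * (u \<bullet> u) \<le> u \<bullet> (S *\<^sub>v u)"
    and ev: "eigenvalue (map_mat complex_of_real S) e"
  shows "Im e = 0 \<and> c \<le> Re e"
proof -
  let ?C = "map_mat complex_of_real S"
  obtain v where v: "v \<in> carrier_vec n" "v \<noteq> 0\<^sub>v n" "?C *\<^sub>v v = e \<cdot>\<^sub>v v"
    using ev S unfolding eigenvalue_def eigenvector_def by auto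
  define x y where "x = map_vec Re v" and "y = map_vec Im v"
  have xy: "x \<in> carrier_vec n" "y \<in> carrier_vec n" using v by (auto simp: x_def y_def)
  have ev_i: "(\<Sum>j<n. complex_of_real (S $$ (i, j)) * v $ j) = e * v $ i" if "i < n" for i
  proof -
    have "(?C *\<^sub>v v) $ i = (e \<cdot>\<^sub>v v) $ i" by (simp only: v(3))
    then show ?thesis using that v(1) S by (simp add: scalar_prod_def lessThan_atLeast0)
  qed
  have Sx: "S *\<^sub>v x = Re e \<cdot>\<^sub>v x - Im e \<cdot>\<^sub>v y"
    using arg_cong[OF ev_i, of _ Re] xy S v
    by (intro eq_vecI) (auto simp: scalar_prod_def lessThan_atLeast0 x_def y_def)
  have Sy: "S *\<^sub>v y = Im e \<cdot>\<^sub>v x + Re e \<cdot>\<^sub>v y"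
    using arg_cong[OF ev_i, of _ Im] xy S v
    by (intro eq_vecI) (auto simp: scalar_prod_def lessThan_atLeast0 x_def y_def algebra_simps)
  let ?N = "x \<bullet> x + y \<bullet> y"
  have "?N \<noteq> 0"
  proof
    assume "?N = 0"
    moreover have "x \<bullet> x \<ge> 0" "y \<bullet> y \<ge> 0"
      by (auto simp: scalar_prod_def intro!: sum_nonneg)
    ultimately have "x \<bullet> x = 0" "y \<bullet> y = 0" by linarith+
    then have "x $ i = 0" "y $ i = 0" if "i < n" for i
      using that xy by (auto simp: scalar_prod_def sum_nonneg_eq_0_iff)
    then have "v = 0\<^sub>v n"
      using v by (intro eq_vecI) (auto simp: x_def y_def complex_eq_iff)
    with v show False by simp
  qed
  moreover have "x \<bullet> x \<ge> 0" "y \<bullet> y \<ge> 0"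
    by (auto simp: scalar_prod_def intro!: sum_nonneg)
  ultimately have N: "?N > 0" by linarith
  have yx: "y \<bullet> x = x \<bullet> y" using xy by (metis comm_scalar_prod)
  have "x \<bullet> (S *\<^sub>v y) = y \<bullet> (S *\<^sub>v x)"
    using transpose_vec_mult_scalar[OF S xy(2) xy(1)] sym S xy
    by (metis comm_scalar_prod mult_mat_vec_carrier)
  then have "Im e * ?N = 0"
    unfolding Sx Sy using xy yx
    by (simp add: scalar_prod_add_distrib[of _ n] scalar_prod_minus_distrib[of _ n] algebra_simps)
  with N have im: "Im e = 0" by simp
  have "c * ?N \<le> x \<bullet> (S *\<^sub>v x) + y \<bullet> (S *\<^sub>v y)"
    using ge[OF xy(1)] ge[OF xy(2)] by (simp add: algebra_simps)
  also have "\<dots> = Re e * ?N"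
    unfolding Sx Sy im using xy
    by (simp add: scalar_prod_add_distrib[of _ n] scalar_prod_minus_distrib[of _ n] algebra_simps)
  finally show ?thesis using N im by simp
qed

text \<open>The determinant is the product of the complex eigenvalues, all of which are real and at
  least \<open>c\<close>.\<close>

lemma det_ge_of_quadratic_form_ge:
  fixes S :: "real mat"
  assumes S: "S \<in> carrier_mat n n" and sym: "transpose_mat S = S" and c: "c \<ge> 0"
    and ge: "\<And>u. u \<in> carrier_vec n \<Longrightarrow> c * (u \<bullet> u) \<le> u \<bullet> (S *\<^sub>v u)"
  shows "c ^ n \<le> det S"
proof -
  let ?C = "map_mat complex_of_real S"
  have C: "?C \<in> carrier_mat n n" using S by simp
  obtain as where as: "char_poly ?C = (\<Prod>a\<leftarrow>as. [:- a, 1:])" "length as = n"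
    using char_poly_factorized[OF C] by auto
  have "char_matrix ?C 0 = ?C"
    using C unfolding char_matrix_def by (intro eq_matI) auto
  moreover have "- ?C = (- 1) \<cdot>\<^sub>m ?C"
    by (intro eq_matI) auto
  \<comment> \<open>The characteristic polynomial at 0 is \<open>det (- ?C)\<close>; its sign
    cancels against that of the product of the \<open>- a\<close>.\<close>
  ultimately have "(-1) ^ n * det ?C = poly (char_poly ?C) 0"
    using char_poly_matrix[OF C, of 0] det_smult[of "-1" ?C] C by simp
  also have "\<dots> = (\<Prod>a\<leftarrow>as. - a)"
    unfolding as by (simp add: poly_prod_list o_def)
  also have "\<dots> = (-1) ^ n * prod_list as"
    unfolding as(2)[symmetric] by (induction as) auto
  finally have det: "complex_of_real (det S) = prod_list as"
    by (simp add: of_real_hom.hom_det)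
  have real: "Im a = 0 \<and> c \<le> Re a" if "a \<in> set as" for a
  proof (rule eigenvalue_of_real_symmetric[OF S sym ge])
    have "poly (char_poly ?C) a = 0"
      unfolding as using that by (auto simp: poly_prod_list prod_list_zero_iff)
    then show "eigenvalue ?C a" using eigenvalue_root_char_poly[OF C] by simp
  qed
  \<comment> \<open>All \<open>a\<close> being real, the real part of the product is the product of
    the real parts; \<open>c \<ge> 0\<close> allows the bounds to be multiplied.\<close>
  have "Im (prod_list as) = 0 \<and> c ^ length as \<le> Re (prod_list as)"
    using real
  proof (induction as)
    case (Cons a as)
    then have IH: "Im (prod_list as) = 0" "c ^ length as \<le> Re (prod_list as)"
      and a: "Im a = 0" "c \<le> Re a" by auto
    then have "c * c ^ length as \<le> Re a * Re (prod_list as)"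
      using c by (intro mult_mono) auto
    with IH a show ?case by simp
  qed simp
  then have "c ^ n \<le> Re (complex_of_real (det S))" unfolding det as(2) by simp
  then show ?thesis by simp
qed

section \<open>Gram determinants through the orthogonal complement\<close>

text \<open>With \<open>C\<close> the block matrix of rows \<open>(D, U)\<close> and \<open>(-V\<^sup>T, P\<^sup>T)\<close>, the hypothesis \<open>D V = U P\<close>
  makes the two block rows orthogonal, so \<open>C C\<^sup>T\<close> is block diagonal; multiplying \<open>C\<close> by the
  second block column of \<open>C\<^sup>T\<close> computes \<open>det C\<close> as well.\<close>

lemma det_gram_complement:
  fixes D U V P :: "real mat"
  assumes D: "D \<in> carrier_mat m m" and U: "U \<in> carrier_mat m n"
    and V: "V \<in> carrier_mat m n" and P: "P \<in> carrier_mat n n"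
    and orth: "D * V = U * P" and detD: "det D = det P" and detP: "det P \<noteq> 0"
    and detS: "det (transpose_mat V * V + transpose_mat P * P) \<noteq> 0"
  shows "det (D * transpose_mat D + U * transpose_mat U)
    = det (transpose_mat V * V + transpose_mat P * P)"
proof -
  let ?G = "D * transpose_mat D + U * transpose_mat U"
  let ?S = "transpose_mat V * V + transpose_mat P * P"
  let ?C = "four_block_mat D U (- transpose_mat V) (transpose_mat P)"
  \<comment> \<open>The column of blocks \<open>- V\<close> and \<open>P\<close> is completed by an
    identity block, so the determinant is \<open>det P\<close>.\<close>
  let ?K = "four_block_mat (1\<^sub>m m) (- V) (0\<^sub>m n m) P"
  let ?CT = "four_block_mat (transpose_mat D) (- V) (transpose_mat U) P"
  have C: "?C \<in> carrier_mat (m + n) (m + n)" and K: "?K \<in> carrier_mat (m + n) (m + n)"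
    and CT: "?CT \<in> carrier_mat (m + n) (m + n)"
    using D U V P by auto
  have Vt: "- transpose_mat V \<in> carrier_mat n m" and Pt: "transpose_mat P \<in> carrier_mat n n"
    and Dt: "transpose_mat D \<in> carrier_mat m m" and Ut: "transpose_mat U \<in> carrier_mat n m"
    and nV: "- V \<in> carrier_mat m n" and O: "1\<^sub>m m \<in> carrier_mat m m"
    and Z: "0\<^sub>m n m \<in> carrier_mat n m"
    using D U V P by auto
  have DV: "D * (- V) + U * P = 0\<^sub>m m n"
    using D U V P orth by (simp add: uminus_l_inv_mat[of _ m n])
  have "transpose_mat (D * (- V) + U * P) = transpose_mat (0\<^sub>m m n)"
    by (simp only: DV)
  then have VD: "- transpose_mat V * transpose_mat D + transpose_mat P * transpose_mat U = 0\<^sub>m n m"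
    using D U V P nV
    by (simp add: transpose_add[of _ m n] transpose_mult[of _ m m _ n] transpose_mult[of _ m n _ n] transpose_uminus)
  have VV: "- transpose_mat V * (- V) + transpose_mat P * P = ?S"
    using V P by (intro arg_cong2[of _ _ _ _ "(+)"] refl) (auto intro!: eq_matI)
  have CK: "?C * ?K = four_block_mat D (0\<^sub>m m n) (- transpose_mat V) ?S"
    unfolding mult_four_block_mat[OF D U Vt Pt O nV Z P] DV VV
    using D U V P by (intro cong_four_block_mat) auto
  have CC: "?C * ?CT = four_block_mat ?G (0\<^sub>m m n) (0\<^sub>m n m) ?S"
    unfolding mult_four_block_mat[OF D U Vt Pt Dt nV Ut P] DV VV VD ..
  have S: "?S \<in> carrier_mat n n" and G: "?G \<in> carrier_mat m m"
    using D U V P by auto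
  have "transpose_mat ?C = ?CT"
    using D U V P transpose_four_block_mat[OF D U Vt Pt] by (simp add: transpose_uminus)
  then have "det ?C * det ?C = det (?C * ?CT)"
    using det_transpose[OF C] det_mult[OF C CT] by simp
  also have "\<dots> = det ?G * det ?S"
    unfolding CC by (rule det_four_block_mat_upper_right_zero[OF G refl Z S])
  finally have 1: "det ?C * det ?C = det ?G * det ?S" .
  have "det ?C * det ?K = det D * det ?S"
    unfolding det_mult[OF C K, symmetric] CK
    by (rule det_four_block_mat_upper_right_zero[OF D refl Vt S])
  moreover have "det ?K = det P"
    using det_four_block_mat_lower_left_zero[OF O nV refl P] by simp
  \<comment> \<open>In \<open>det ?C * det P = det D * det ?S\<close> the equal nonzero factors
    \<open>det P\<close> and \<open>det D\<close> cancel.\<close>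
  ultimately have "det ?C = det ?S" using detD detP by simp
  with 1 detS show ?thesis by simp
qed

section \<open>Block matrices in flat indices\<close>

text \<open>The numbers below \<open>k * n\<close> are exactly the \<open>q * n + i\<close> with
  \<open>q < k\<close> and \<open>i < n\<close>.\<close>

lemma sum_div_mod:
  fixes g :: "nat \<Rightarrow> nat \<Rightarrow> 'a :: comm_monoid_add"
  shows "(\<Sum>j<k * n. g (j div n) (j mod n)) = (\<Sum>q<k. \<Sum>i<n. g q i)"
proof -
  have "(\<Sum>j<k * n. g (j div n) (j mod n)) = (\<Sum>q<k. \<Sum>j=q * n..<q * n + n. g (j div n) (j mod n))"
    by (rule sum.nat_group[symmetric])
  also have "\<dots> = (\<Sum>q<k. \<Sum>i<n. g q i)"
  proof (rule sum.cong[OF refl])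
    fix q
    show "(\<Sum>j=q * n..<q * n + n. g (j div n) (j mod n)) = (\<Sum>i<n. g q i)"
      by (rule sum.reindex_bij_witness[of _ "\<lambda>i. q * n + i" "\<lambda>j. j - q * n"])
        (auto simp: div_nat_eqI mult.commute modulo_nat_def)
  qed
  finally show ?thesis .
qed

text \<open>Indices are split by \<open>div\<close> and \<open>mod\<close> as in
  \<open>Bt_mat\<close>. Blocks count from 0, so block \<open>q\<close> later carries the data of
  index \<open>q + 1\<close>.\<close>

definition block_diag :: "nat \<Rightarrow> nat \<Rightarrow> (nat \<Rightarrow> 'a :: zero mat) \<Rightarrow> 'a mat" where
  "block_diag n k F = mat (k * n) (k * n)
    (\<lambda>(r, c). if r div n = c div n then F (r div n) $$ (r mod n, c mod n) else 0)"

definition block_col :: "nat \<Rightarrow> nat \<Rightarrow> (nat \<Rightarrow> 'a mat) \<Rightarrow> 'a mat" where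
  "block_col n k H = mat (k * n) n (\<lambda>(r, c). H (r div n) $$ (r mod n, c))"

lemma block_diag_carrier [simp]: "block_diag n k F \<in> carrier_mat (k * n) (k * n)"
  by (simp add: block_diag_def)

lemma block_col_carrier [simp]: "block_col n k H \<in> carrier_mat (k * n) n"
  by (simp add: block_col_def)

lemma block_diag_mult_block_col:
  fixes F H :: "nat \<Rightarrow> 'a :: semiring_0 mat"
  assumes F: "\<And>q. q < k \<Longrightarrow> F q \<in> carrier_mat n n" and H: "\<And>q. q < k \<Longrightarrow> H q \<in> carrier_mat n n"
  shows "block_diag n k F * block_col n k H = block_col n k (\<lambda>q. F q * H q)"
proof (rule eq_matI)
  fix r c
  assume "r < dim_row (block_col n k (\<lambda>q. F q * H q))" "c < dim_col (block_col n k (\<lambda>q. F q * H q))"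
  then have r: "r < k * n" and c: "c < n" by (simp_all add: block_col_def)
  then have n: "n > 0" and q: "r div n < k" by (auto simp: less_mult_imp_div_less)
  let ?g = "\<lambda>p i. (if r div n = p then F (r div n) $$ (r mod n, i) else 0) * H p $$ (i, c)"
  have "(block_diag n k F * block_col n k H) $$ (r, c) = (\<Sum>j<k * n. ?g (j div n) (j mod n))"
    using r c unfolding block_diag_def block_col_def
    by (simp add: scalar_prod_def lessThan_atLeast0)
  also have "\<dots> = (\<Sum>p<k. \<Sum>i<n. ?g p i)"
    by (rule sum_div_mod)
  also have "\<dots> = (\<Sum>p<k. if r div n = p then \<Sum>i<n. F p $$ (r mod n, i) * H p $$ (i, c) else 0)"
    by (intro sum.cong refl) auto
  also have "\<dots> = (F (r div n) * H (r div n)) $$ (r mod n, c)"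
    using q n c F[OF q] H[OF q] by (simp add: scalar_prod_def lessThan_atLeast0)
  finally show "(block_diag n k F * block_col n k H) $$ (r, c) = block_col n k (\<lambda>q. F q * H q) $$ (r, c)"
    using r c by (simp add: block_col_def)
qed (auto simp: block_diag_def block_col_def)

lemma block_col_mult:
  fixes H :: "nat \<Rightarrow> 'a :: semiring_0 mat"
  assumes H: "\<And>q. q < k \<Longrightarrow> H q \<in> carrier_mat n n" and P: "P \<in> carrier_mat n n"
  shows "block_col n k H * P = block_col n k (\<lambda>q. H q * P)"
proof (rule eq_matI)
  fix r c
  assume "r < dim_row (block_col n k (\<lambda>q. H q * P))" "c < dim_col (block_col n k (\<lambda>q. H q * P))"
  then have r: "r < k * n" and c: "c < n" by (simp_all add: block_col_def)
  then have n: "n > 0" and q: "r div n < k" by (auto simp: less_mult_imp_div_less)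
  show "(block_col n k H * P) $$ (r, c) = block_col n k (\<lambda>q. H q * P) $$ (r, c)"
    using r c n P H[OF q] by (simp add: block_col_def scalar_prod_def)
qed (use P in \<open>auto simp: block_col_def\<close>)

lemma block_col_mult_vec_index:
  assumes H: "\<And>q. q < k \<Longrightarrow> H q \<in> carrier_mat n n" and u: "u \<in> carrier_vec n" and r: "r < k * n"
  shows "(block_col n k H *\<^sub>v u) $ r = (H (r div n) *\<^sub>v u) $ (r mod n)"
proof -
  have n: "n > 0" using r by (cases "n = 0") auto
  have q: "r div n < k" using r by (rule less_mult_imp_div_less)
  show ?thesis
    using r n u H[OF q] by (simp add: block_col_def scalar_prod_def)
qed

text \<open>Induction on the number of blocks, splitting off the last diagonal block.\<close>

lemma det_block_diag:
  fixes F :: "nat \<Rightarrow> 'a :: idom mat"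
  assumes n: "n > 0" and F: "\<And>q. q < k \<Longrightarrow> F q \<in> carrier_mat n n"
  shows "det (block_diag n k F) = (\<Prod>q<k. det (F q))"
  using F
proof (induction k)
  case 0
  have "block_diag n 0 F \<in> carrier_mat 0 0" using block_diag_carrier[of n 0 F] by simp
  then show ?case by (simp add: det_dim_zero)
next
  case (Suc k)
  have last: "r div n = k \<and> r mod n = r - k * n" if "\<not> r < k * n" "r < Suc k * n" for r
  proof -
    have "r div n = k" using that by (intro div_nat_eqI) (auto simp: mult.commute)
    then show ?thesis by (simp add: modulo_nat_def)
  qed
  have less: "r div n < k" if "r < k * n" for r
    using that by (rule less_mult_imp_div_less)
  have "block_diag n (Suc k) F = four_block_mat (block_diag n k F) (0\<^sub>m (k * n) n) (0\<^sub>m n (k * n)) (F k)"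
  proof (rule eq_matI)
    fix r c
    assume "r < dim_row (four_block_mat (block_diag n k F) (0\<^sub>m (k * n) n) (0\<^sub>m n (k * n)) (F k))"
      "c < dim_col (four_block_mat (block_diag n k F) (0\<^sub>m (k * n) n) (0\<^sub>m n (k * n)) (F k))"
    then have r: "r < Suc k * n" and c: "c < Suc k * n"
      using Suc.prems[of k] by (auto simp: block_diag_def)
    show "block_diag n (Suc k) F $$ (r, c)
        = four_block_mat (block_diag n k F) (0\<^sub>m (k * n) n) (0\<^sub>m n (k * n)) (F k) $$ (r, c)"
      using r c last[OF _ r] last[OF _ c] less[of r] less[of c] Suc.prems[of k]
      by (cases "r < k * n"; cases "c < k * n") (auto simp: block_diag_def)
  qed (use Suc.prems[of k] in \<open>auto simp: block_diag_def\<close>)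
  then have "det (block_diag n (Suc k) F) = det (block_diag n k F) * det (F k)"
    using det_four_block_mat_upper_right_zero[of "block_diag n k F" "k * n" _ n "0\<^sub>m n (k * n)" "F k"]
      Suc.prems by simp
  then show ?case using Suc by simp
qed

section \<open>Products of consecutive commuting matrices\<close>

text \<open>Indices are not reduced modulo \<open>n\<close>; products wrap around because they are
  applied to families of period \<open>n\<close>.\<close>

fun consec_prod :: "nat \<Rightarrow> (nat \<Rightarrow> 'a :: semiring_1 mat) \<Rightarrow> nat \<Rightarrow> nat \<Rightarrow> 'a mat" where
  "consec_prod n M i 0 = 1\<^sub>m n"
| "consec_prod n M i (Suc m) = M i * consec_prod n M (Suc i) m"

context
  fixes n :: nat and M :: "nat \<Rightarrow> 'a :: comm_ring_1 mat"
  assumes M: "\<And>i. M i \<in> carrier_mat n n"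
begin

lemma consec_prod_carrier: "consec_prod n M i m \<in> carrier_mat n n"
  by (induction m arbitrary: i) (auto intro: mult_carrier_mat M)

lemma consec_prod_commute:
  assumes comm: "\<And>i j. M i * M j = M j * M i"
  shows "M j * consec_prod n M i m = consec_prod n M i m * M j"
proof (induction m arbitrary: i)
  case 0
  then show ?case using M[of j] by simp
next
  case (Suc m)
  let ?X = "consec_prod n M (Suc i) m"
  have "M j * (M i * ?X) = (M i * M j) * ?X"
    unfolding comm[of i j] by (rule assoc_mult_mat[symmetric, OF M M consec_prod_carrier])
  also have "\<dots> = M i * (M j * ?X)"
    by (rule assoc_mult_mat[OF M M consec_prod_carrier])
  also have "\<dots> = M i * ?X * M j"
    unfolding Suc by (rule assoc_mult_mat[symmetric, OF M consec_prod_carrier M])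
  finally show ?case by simp
qed

text \<open>The recursion peels off the first factor, this equation the last; both are needed to
  compare neighbouring products, which differ at their ends.\<close>

lemma consec_prod_Suc_right:
  "consec_prod n M i (Suc m) = consec_prod n M i m * M (i + m)"
proof (induction m arbitrary: i)
  case 0
  then show ?case using M[of i] by simp
next
  case (Suc m)
  have "consec_prod n M i (Suc (Suc m)) = M i * (consec_prod n M (Suc i) m * M (Suc i + m))"
    using Suc[of "Suc i"] by simp
  also have "\<dots> = consec_prod n M i (Suc m) * M (i + Suc m)"
    using assoc_mult_mat[OF M consec_prod_carrier M, of i "Suc i" m "Suc i + m"] by simp
  finally show ?case .
qed

lemma consec_prod_periodic:
  assumes "\<And>i. M (i + p) = M i"
  shows "consec_prod n M (i + p) m = consec_prod n M i m"
  by (induction m arbitrary: i) (use assms in \<open>auto simp flip: add_Suc\<close>)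

lemma det_consec_prod: "det (consec_prod n M i m) = (\<Prod>q<m. det (M (i + q)))"
proof (induction m)
  case (Suc m)
  then show ?case
    unfolding consec_prod_Suc_right
    using det_mult[OF consec_prod_carrier M] by simp
qed simp

end

section \<open>Continuity and generic invertibility\<close>

text \<open>By the Leibniz formula the determinant is a polynomial in the entries.\<close>

lemma isCont_det:
  fixes F :: "'b :: t2_space \<Rightarrow> real mat"
  assumes F: "\<And>t. F t \<in> carrier_mat m m"
    and cont: "\<And>i j. i < m \<Longrightarrow> j < m \<Longrightarrow> isCont (\<lambda>t. F t $$ (i, j)) x"
  shows "isCont (\<lambda>t. det (F t)) x"
  unfolding det_def'[OF F]
  by (intro continuous_intros cont) (use permutes_in_image in fastforce)+

text \<open>Up to sign the determinant is the characteristic polynomial of \<open>A\<close> at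
  \<open>l - t\<close>, which has finitely many roots.\<close>

lemma eventually_det_shift_nonzero:
  fixes A :: "real mat"
  assumes A: "A \<in> carrier_mat n n"
  shows "eventually (\<lambda>t. det (A + t \<cdot>\<^sub>m 1\<^sub>m n - l \<cdot>\<^sub>m 1\<^sub>m n) \<noteq> 0) (at x)"
proof -
  let ?E = "{e. poly (char_poly A) e = 0}"
  have "char_poly A \<noteq> 0" using degree_monic_char_poly[OF A] by auto
  then have fin: "finite ?E" by (rule poly_roots_finite)
  \<comment> \<open>The filter \<open>at x\<close> leaves out \<open>x\<close>, so the case that
    \<open>l - x\<close> is itself a root is covered.\<close>
  have "eventually (\<lambda>t. \<forall>e\<in>?E. t \<noteq> l - e) (at x)"
    by (rule eventually_ball_finite[OF fin]) (auto intro: eventually_neq_at_within)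
  then show ?thesis
  proof eventually_elim
    case (elim t)
    have "A + t \<cdot>\<^sub>m 1\<^sub>m n - l \<cdot>\<^sub>m 1\<^sub>m n = char_matrix A (l - t)"
      using A unfolding char_matrix_def by (intro eq_matI) (auto simp: algebra_simps)
    moreover have "poly (char_poly A) (l - t) \<noteq> 0" using elim by auto
    ultimately show ?case using eigenvalue_det[OF A] eigenvalue_root_char_poly[OF A] by auto
  qed
qed

section \<open>Shifted matrices and the lower bound for the quadratic form\<close>

text \<open>Reduction by \<open>cyc\<close> gives the family period \<open>n\<close>, as the cyclic
  products require.\<close>

definition shift_mat :: "nat \<Rightarrow> (nat \<Rightarrow> real) \<Rightarrow> real mat \<Rightarrow> nat \<Rightarrow> real mat" where
  "shift_mat n lam A i = A - lam (cyc n i) \<cdot>\<^sub>m 1\<^sub>m n"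

lemma shift_mat_carrier: "A \<in> carrier_mat n n \<Longrightarrow> shift_mat n lam A i \<in> carrier_mat n n"
  unfolding shift_mat_def by (rule minus_carrier_mat) simp

lemma shift_mat_periodic: "shift_mat n lam A (i + n) = shift_mat n lam A i"
  by (simp add: shift_mat_def cyc_add_period)

text \<open>Both products expand to an expression that is symmetric in \<open>a\<close> and
  \<open>b\<close>.\<close>

lemma minus_smult_one_commute:
  fixes A :: "'a :: comm_ring_1 mat"
  assumes A: "A \<in> carrier_mat n n"
  shows "(A - a \<cdot>\<^sub>m 1\<^sub>m n) * (A - b \<cdot>\<^sub>m 1\<^sub>m n) = (A - b \<cdot>\<^sub>m 1\<^sub>m n) * (A - a \<cdot>\<^sub>m 1\<^sub>m n)"
proof -
  have "(A - a \<cdot>\<^sub>m 1\<^sub>m n) * (A - b \<cdot>\<^sub>m 1\<^sub>m n) = A * A - b \<cdot>\<^sub>m A - (a \<cdot>\<^sub>m A - (a * b) \<cdot>\<^sub>m 1\<^sub>m n)" for a b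
  proof -
    have "(A - a \<cdot>\<^sub>m 1\<^sub>m n) * (A - b \<cdot>\<^sub>m 1\<^sub>m n)
        = A * (A - b \<cdot>\<^sub>m 1\<^sub>m n) - a \<cdot>\<^sub>m 1\<^sub>m n * (A - b \<cdot>\<^sub>m 1\<^sub>m n)"
      using A by (intro minus_mult_distrib_mat) auto
    also have "A * (A - b \<cdot>\<^sub>m 1\<^sub>m n) = A * A - b \<cdot>\<^sub>m A"
      using A mult_smult_distrib[of A n n "1\<^sub>m n" n b]
      by (simp add: mult_minus_distrib_mat[of _ n n _ n])
    also have "a \<cdot>\<^sub>m 1\<^sub>m n * (A - b \<cdot>\<^sub>m 1\<^sub>m n) = a \<cdot>\<^sub>m A - (a * b) \<cdot>\<^sub>m 1\<^sub>m n"
    proof -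
      have X: "A - b \<cdot>\<^sub>m 1\<^sub>m n \<in> carrier_mat n n"
        by (rule minus_carrier_mat) simp
      show ?thesis
        using mult_smult_assoc_mat[of "1\<^sub>m n" n n _ n a, OF _ X] X A
        by (auto intro!: eq_matI simp: algebra_simps)
    qed
    finally show ?thesis .
  qed
  from this[of a b] this[of b a] show ?thesis
    using A by (auto intro!: eq_matI simp: algebra_simps)
qed

lemma minus_smult_one_mult_vec_index:
  fixes A :: "'a :: comm_ring_1 mat"
  assumes A: "A \<in> carrier_mat n n" and w: "w \<in> carrier_vec n" and r: "r < n"
  shows "((A - a \<cdot>\<^sub>m 1\<^sub>m n) *\<^sub>v w) $ r = (A *\<^sub>v w) $ r - a * w $ r"
  using A w r by (simp add: minus_mult_distrib_mat_vec[of _ n n])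

lemma scalar_prod_self: "(v :: real vec) \<bullet> v = (\<Sum>r<dim_vec v. (v $ r)\<^sup>2)"
  by (simp add: scalar_prod_def power2_eq_square lessThan_atLeast0)

text \<open>Block \<open>q\<close> of \<open>V\<close> omits only the factor
  \<open>M (q + 1)\<close>: its product starts at \<open>q + 2\<close> and has \<open>n - 1\<close>
  factors. The inequality is proved for each coordinate of \<open>u\<close> and then summed.\<close>

lemma gram_vec_norm_ge:
  fixes A :: "real mat" and lam bet :: "nat \<Rightarrow> real"
  assumes n: "n \<ge> 2" and A: "A \<in> carrier_mat n n" and u: "u \<in> carrier_vec n"
  defines "M \<equiv> shift_mat n lam A"
  defines "V \<equiv> block_col n n (\<lambda>q. bet (q + 1) \<cdot>\<^sub>m consec_prod n M (q + 2) (n - 1))"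
  defines "c \<equiv> (1 / 2) ^ (n - 2) * ((\<Sum>(i, j)\<in>idx_pairs n.
      gam n lam bet (n - 1) i * gam n lam bet (n - 1) j
        * (lam (cyc n (n + i - 1)) - lam (cyc n (n + j - 1)))\<^sup>2)
    / (\<Sum>i=1..n. gam n lam bet (n - 1) i))"
  shows "c * (u \<bullet> u) \<le> (V *\<^sub>v u) \<bullet> (V *\<^sub>v u)"
proof -
  have M: "M i \<in> carrier_mat n n" for i
    unfolding M_def using A by (rule shift_mat_carrier)
  have per: "M (i + n) = M i" for i
    unfolding M_def by (rule shift_mat_periodic)
  note C = consec_prod_carrier[of M n, OF M]
  have comm: "M i * M j = M j * M i" for i j
    unfolding M_def shift_mat_def by (rule minus_smult_one_commute[OF A])
  define z where "z r i m = (consec_prod n M i m *\<^sub>v u) $ r" for r i m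
  have Mv: "(M i *\<^sub>v w) $ r = (A *\<^sub>v w) $ r - lam (cyc n i) * w $ r"
    if "w \<in> carrier_vec n" "r < n" for i w r
    unfolding M_def shift_mat_def by (rule minus_smult_one_mult_vec_index[OF A that])
  \<comment> \<open>A product is read with its first factor outermost, and in \<open>zS'\<close>
    with its last one, which commutation brings to the front.\<close>
  have zS: "z r i (Suc m) = (M i *\<^sub>v (consec_prod n M (Suc i) m *\<^sub>v u)) $ r" for r i m
    unfolding z_def using assoc_mult_mat_vec[OF M C u] by simp
  have zS': "z r i (Suc m) = (M (i + m) *\<^sub>v (consec_prod n M i m *\<^sub>v u)) $ r" for r i m
    unfolding z_def consec_prod_Suc_right[of M n, OF M]
      consec_prod_commute[of M n, OF M comm, symmetric]
    using assoc_mult_mat_vec[OF M C u] by simp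
  have periodic: "z r (i + n) m = z r i m" for r i m
    unfolding z_def consec_prod_periodic[of M n, OF M per] ..
  \<comment> \<open>Both products contain the \<open>n - Suc k\<close> factors from
    \<open>i + Suc k\<close> on. The remaining factors \<open>M (i + k)\<close> and
    \<open>M (i + n) = M i\<close> differ by a multiple of the identity.\<close>
  have diff: "z r (i + k) (n - k) - z r (i + 1 + k) (n - k)
      = (lam i - lam (cyc n (i + k))) * z r (i + Suc k) (n - Suc k)"
    if r: "r < n" and i: "i \<in> {1..n}" and k: "k < n" for r i k
  proof -
    define m where "m = n - Suc k"
    have m: "n - k = Suc m" "i + 1 + k + m = i + n" using k by (auto simp: m_def)
    let ?w = "consec_prod n M (i + Suc k) m *\<^sub>v u"
    have w: "?w \<in> carrier_vec n" using C u by (rule mult_mat_vec_carrier)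
    have "z r (i + k) (n - k) = (M (i + k) *\<^sub>v ?w) $ r"
      unfolding m zS by simp
    moreover have "z r (i + 1 + k) (n - k) = (M i *\<^sub>v ?w) $ r"
      unfolding m(1) zS' m(2) per by simp
    moreover have "?w $ r = z r (i + Suc k) (n - Suc k)"
      by (simp add: z_def m_def)
    ultimately show ?thesis
      unfolding Mv[OF w r] cyc_self[OF i] by (simp add: algebra_simps)
  qed
  have coord: "c * (u $ r)\<^sup>2 \<le> (\<Sum>i=1..n. (bet i)\<^sup>2 * (z r (i + 1) (n - 1))\<^sup>2)" if r: "r < n" for r
  proof -
    let ?g = "gam n lam bet (n - 1)"
    have idx: "Suc (n - 2) = n - 1" "n - Suc (n - 2) = 1" using n by auto
    \<comment> \<open>Here \<open>a\<close> is \<open>(A *\<^sub>v u) $ r\<close> and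
      \<open>b\<close> is \<open>u $ r\<close>; uniformity in \<open>a\<close> keeps the bound free
      of \<open>A\<close>.\<close>
    have "c * (u $ r)\<^sup>2 \<le> (1 / 2) ^ (n - 2)
        * (\<Sum>i=1..n. ?g i * ((A *\<^sub>v u) $ r - lam (cyc n (n + i - 1)) * u $ r)\<^sup>2)"
      using mult_left_mono[OF weighted_square_distance_ge[of n ?g "\<lambda>i. lam (cyc n (n + i - 1))" "u $ r" "(A *\<^sub>v u) $ r"],
        of "(1 / 2) ^ (n - 2)"] gam_nonneg
      unfolding c_def by (simp add: mult.assoc)
    also have "(\<Sum>i=1..n. ?g i * ((A *\<^sub>v u) $ r - lam (cyc n (n + i - 1)) * u $ r)\<^sup>2)
        = (\<Sum>i=1..n. ?g i * (z r (i + (n - 1)) 1)\<^sup>2)"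
    proof (intro sum.cong refl)
      fix i assume "i \<in> {1..n}"
      then have "n + i - 1 = i + (n - 1)" using n by auto
      moreover have "z r (i + (n - 1)) 1 = (M (i + (n - 1)) *\<^sub>v u) $ r"
        using zS[of r "i + (n - 1)" 0] u by simp
      ultimately show "?g i * ((A *\<^sub>v u) $ r - lam (cyc n (n + i - 1)) * u $ r)\<^sup>2
          = ?g i * (z r (i + (n - 1)) 1)\<^sup>2"
        using Mv[OF u r] by simp
    qed
    finally have le1: "c * (u $ r)\<^sup>2 \<le> (1 / 2) ^ (n - 2) * (\<Sum>i=1..n. ?g i * (z r (i + (n - 1)) 1)\<^sup>2)" .
    \<comment> \<open>After \<open>n - 2\<close> rounds the products have length 1; the loss is
      exactly the power of 2 put into \<open>c\<close>.\<close>
    have le2: "(\<Sum>i=1..n. ?g i * (z r (i + (n - 1)) 1)\<^sup>2)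
        \<le> 2 ^ (n - 2) * (\<Sum>i=1..n. (bet i)\<^sup>2 * (z r (i + 1) (n - 1))\<^sup>2)"
      using gam_sum_ge[of "z r" n lam "n - 2" bet, OF periodic diff[OF r]] n unfolding idx by simp
    have "c * (u $ r)\<^sup>2
        \<le> (1 / 2) ^ (n - 2) * (2 ^ (n - 2) * (\<Sum>i=1..n. (bet i)\<^sup>2 * (z r (i + 1) (n - 1))\<^sup>2))"
      by (rule order_trans[OF le1 mult_left_mono[OF le2]]) simp
    then show ?thesis by (simp add: power_one_over)
  qed
  \<comment> \<open>The squared norm is a double sum over blocks and coordinates; exchanging the
    sums prepares for \<open>coord\<close>.\<close>
  have "(V *\<^sub>v u) \<bullet> (V *\<^sub>v u)
      = (\<Sum>r<n * n. (((bet (r div n + 1) \<cdot>\<^sub>m consec_prod n M (r div n + 2) (n - 1)) *\<^sub>v u) $ (r mod n))\<^sup>2)"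
    unfolding scalar_prod_self
  proof (rule sum.cong)
    show "{..<dim_vec (V *\<^sub>v u)} = {..<n * n}"
      by (simp add: V_def block_col_def)
    fix r assume "r \<in> {..<n * n}"
    then show "((V *\<^sub>v u) $ r)\<^sup>2
        = (((bet (r div n + 1) \<cdot>\<^sub>m consec_prod n M (r div n + 2) (n - 1)) *\<^sub>v u) $ (r mod n))\<^sup>2"
      using C u unfolding V_def by (subst block_col_mult_vec_index) auto
  qed
  also have "\<dots> = (\<Sum>q<n. \<Sum>r<n. (((bet (q + 1) \<cdot>\<^sub>m consec_prod n M (q + 2) (n - 1)) *\<^sub>v u) $ r)\<^sup>2)"
    by (rule sum_div_mod)
  also have "\<dots> = (\<Sum>q<n. \<Sum>r<n. (bet (q + 1))\<^sup>2 * (z r (q + 1 + 1) (n - 1))\<^sup>2)"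
  proof (rule sum.cong[OF refl], rule sum.cong[OF refl])
    fix q r assume "r \<in> {..<n}"
    then show "(((bet (q + 1) \<cdot>\<^sub>m consec_prod n M (q + 2) (n - 1)) *\<^sub>v u) $ r)\<^sup>2
        = (bet (q + 1))\<^sup>2 * (z r (q + 1 + 1) (n - 1))\<^sup>2"
      using C[of "q + 2" "n - 1"] u by (simp add: z_def power_mult_distrib)
  qed
  also have "\<dots> = (\<Sum>i=1..n. \<Sum>r<n. (bet i)\<^sup>2 * (z r (i + 1) (n - 1))\<^sup>2)"
    by (rule sum.reindex_bij_witness[of _ "\<lambda>i. i - 1" "\<lambda>q. q + 1"]) auto
  also have "\<dots> = (\<Sum>r<n. \<Sum>i=1..n. (bet i)\<^sup>2 * (z r (i + 1) (n - 1))\<^sup>2)"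
    by (rule sum.swap)
  also have "\<dots> \<ge> (\<Sum>r<n. c * (u $ r)\<^sup>2)"
    by (intro sum_mono coord) simp
  finally show ?thesis
    using u unfolding scalar_prod_self by (simp add: sum_distrib_left)
qed

section \<open>The matrix B and its Gram determinant\<close>

lemma B_mat_carrier: "B_mat n lam bet A \<in> carrier_mat (n * n) (n * n + n)"
  by (simp add: B_mat_def Bt_mat_def power2_eq_square)

text \<open>Transposing \<open>Bt_mat\<close> cancels the transposes of its diagonal blocks, so
  \<open>B_mat\<close> is a block diagonal matrix followed by one block column.\<close>

lemma B_mat_index:
  assumes A: "A \<in> carrier_mat n n" and r: "r < n * n" and c: "c < n * n + n"
  shows "B_mat n lam bet A $$ (r, c) =
    (if c < n * n then block_diag n n (\<lambda>q. shift_mat n lam A (q + 1)) $$ (r, c)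
     else block_col n n (\<lambda>q. bet (q + 1) \<cdot>\<^sub>m 1\<^sub>m n) $$ (r, c - n * n))"
proof -
  have n: "n > 0" using r by (cases "n = 0") auto
  have B: "B_mat n lam bet A $$ (r, c)
      = Bt_block n lam bet A (c div n + 1) (r div n + 1) $$ (c mod n, r mod n)"
    using r c by (simp add: B_mat_def Bt_mat_def power2_eq_square)
  have q: "r div n < n" using r by (rule less_mult_imp_div_less)
  show ?thesis
  proof (cases "c < n * n")
    case True
    then have "c div n < n" by (rule less_mult_imp_div_less)
    then show ?thesis
      unfolding B using True r n A cyc_self[of "r div n + 1" n] q
      by (auto simp: Bt_block_def block_diag_def shift_mat_def)
  next
    case False
    \<comment> \<open>Thus \<open>c div n + 1 = n + 1\<close>, the last block row of the
      transpose.\<close>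
    have "c div n = n" using False c by (intro div_nat_eqI) auto
    moreover have "c mod n = c - n * n"
      using \<open>c div n = n\<close> by (simp add: modulo_nat_def)
    ultimately show ?thesis
      unfolding B using False r n c by (auto simp: Bt_block_def block_col_def)
  qed
qed

lemma B_mat_gram:
  fixes lam bet :: "nat \<Rightarrow> real"
  assumes A: "A \<in> carrier_mat n n"
  defines "D \<equiv> block_diag n n (\<lambda>q. shift_mat n lam A (q + 1))"
    and "U \<equiv> block_col n n (\<lambda>q. bet (q + 1) \<cdot>\<^sub>m 1\<^sub>m n)"
  shows "B_mat n lam bet A * transpose_mat (B_mat n lam bet A)
    = D * transpose_mat D + U * transpose_mat U"
proof (rule eq_matI)
  let ?B = "B_mat n lam bet A"
  have D: "D \<in> carrier_mat (n * n) (n * n)" and U: "U \<in> carrier_mat (n * n) n"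
    by (simp_all add: D_def U_def)
  fix r s
  assume "r < dim_row (D * transpose_mat D + U * transpose_mat U)"
    "s < dim_col (D * transpose_mat D + U * transpose_mat U)"
  then have r: "r < n * n" and s: "s < n * n" using D U by auto
  have split: "(\<Sum>j<a + b. f j) = (\<Sum>j<a. f j) + (\<Sum>j<b. f (a + j))" for a b and f :: "nat \<Rightarrow> real"
    by (induction b) (auto simp: add.assoc)
  have "(?B * transpose_mat ?B) $$ (r, s) = (\<Sum>j<n * n + n. ?B $$ (r, j) * ?B $$ (s, j))"
    using r s B_mat_carrier[of n lam bet A] by (simp add: scalar_prod_def lessThan_atLeast0)
  also have "\<dots> = (\<Sum>j<n * n. D $$ (r, j) * D $$ (s, j)) + (\<Sum>j<n. U $$ (r, j) * U $$ (s, j))"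
    unfolding split using r s
    by (intro arg_cong2[of _ _ _ _ "(+)"] sum.cong refl) (simp_all add: B_mat_index[OF A] D_def U_def)
  also have "\<dots> = (D * transpose_mat D + U * transpose_mat U) $$ (r, s)"
    using r s D U by (simp add: scalar_prod_def lessThan_atLeast0)
  finally show "(?B * transpose_mat ?B) $$ (r, s) = (D * transpose_mat D + U * transpose_mat U) $$ (r, s)" .
qed (use B_mat_carrier[of n lam bet A] in \<open>auto simp: D_def U_def block_diag_def block_col_def\<close>)

text \<open>With all shifts invertible, \<open>det_gram_complement\<close> replaces the determinant
  of size \<open>n * n\<close> by one of size \<open>n\<close>, whose quadratic form is at least the
  squared norm bounded in \<open>gram_vec_norm_ge\<close>.\<close>

lemma det_B_mat_gram_ge:
  fixes A :: "real mat"
  assumes n: "n \<ge> 2" and A: "A \<in> carrier_mat n n"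
    and nz: "\<And>q. q < n \<Longrightarrow> det (A - lam (q + 1) \<cdot>\<^sub>m 1\<^sub>m n) \<noteq> 0"
    and c: "c \<ge> 0" "c = (1 / 2) ^ (n - 2) * ((\<Sum>(i, j)\<in>idx_pairs n.
      gam n lam bet (n - 1) i * gam n lam bet (n - 1) j
        * (lam (cyc n (n + i - 1)) - lam (cyc n (n + j - 1)))\<^sup>2)
    / (\<Sum>i=1..n. gam n lam bet (n - 1) i))"
  shows "c ^ n \<le> det (B_mat n lam bet A * transpose_mat (B_mat n lam bet A))"
proof -
  define M where "M = shift_mat n lam A"
  define D where "D = block_diag n n (\<lambda>q. M (q + 1))"
  define U :: "real mat" where "U = block_col n n (\<lambda>q. bet (q + 1) \<cdot>\<^sub>m 1\<^sub>m n)"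
  define V where "V = block_col n n (\<lambda>q. bet (q + 1) \<cdot>\<^sub>m consec_prod n M (q + 2) (n - 1))"
  define P where "P = consec_prod n M 1 n"
  define S where "S = transpose_mat V * V + transpose_mat P * P"
  have M: "M i \<in> carrier_mat n n" for i
    unfolding M_def using A by (rule shift_mat_carrier)
  have per: "M (i + n) = M i" for i
    unfolding M_def by (rule shift_mat_periodic)
  note C = consec_prod_carrier[of M n, OF M]
  have comm: "M i * M j = M j * M i" for i j
    unfolding M_def shift_mat_def by (rule minus_smult_one_commute[OF A])
  have D: "D \<in> carrier_mat (n * n) (n * n)" and U: "U \<in> carrier_mat (n * n) n"
    and V: "V \<in> carrier_mat (n * n) n" and P: "P \<in> carrier_mat n n"
    using C by (simp_all add: D_def U_def V_def P_def)
  then have S: "S \<in> carrier_mat n n" by (auto simp: S_def)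
  \<comment> \<open>The full product does not depend on its starting index: by periodicity its last
    factor is \<open>M (q + 1)\<close>, which commutes to the front.\<close>
  have full: "consec_prod n M (q + 1) n = P" for q
  proof (induction q)
    case (Suc q)
    obtain m where m: "n = Suc m" using n by (cases n) auto
    have "consec_prod n M (Suc q + 1) n = consec_prod n M (q + 2) m * M (q + 1)"
      using per[of "q + 1"] consec_prod_Suc_right[of M n, OF M, of "q + 2" m] by (simp add: m)
    also have "\<dots> = M (q + 1) * consec_prod n M (q + 2) m"
      by (rule consec_prod_commute[of M n, OF M comm, symmetric])
    also have "\<dots> = consec_prod n M (q + 1) n"
      by (simp add: m)
    finally show ?case unfolding Suc .
  qed (simp add: P_def)
  \<comment> \<open>Restoring the omitted factor gives \<open>P\<close>; over all blocks this is
    \<open>D * V = U * P\<close>.\<close>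
  have "M (q + 1) * (bet (q + 1) \<cdot>\<^sub>m consec_prod n M (q + 2) (n - 1)) = bet (q + 1) \<cdot>\<^sub>m 1\<^sub>m n * P" for q
  proof -
    have "M (q + 1) * consec_prod n M (q + 2) (n - 1) = P"
      using full[of q] n by (cases n) auto
    then show ?thesis
      using mult_smult_distrib[OF M C] P mult_smult_assoc_mat[of "1\<^sub>m n" n n P n] by simp
  qed
  then have orth: "D * V = U * P"
    unfolding D_def V_def U_def using M C P
    by (subst block_diag_mult_block_col, simp, simp, subst block_col_mult) auto
  \<comment> \<open>\<open>D\<close> and \<open>P\<close> are built from the same \<open>n\<close>
    factors, so their determinants agree.\<close>
  have detP: "det P = (\<Prod>q<n. det (M (q + 1)))"
    unfolding P_def by (simp add: det_consec_prod[of M n, OF M])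
  have detD: "det D = det P"
    unfolding detP D_def using n M by (intro det_block_diag) auto
  have "det (M (q + 1)) \<noteq> 0" if "q < n" for q
    using nz[OF that] that by (simp add: M_def shift_mat_def cyc_self)
  then have detP0: "det P \<noteq> 0" unfolding detP by simp
  have form: "u \<bullet> (S *\<^sub>v u) = (V *\<^sub>v u) \<bullet> (V *\<^sub>v u) + (P *\<^sub>v u) \<bullet> (P *\<^sub>v u)"
    if u: "u \<in> carrier_vec n" for u
  proof -
    have "u \<bullet> (transpose_mat X * X *\<^sub>v u) = (X *\<^sub>v u) \<bullet> (X *\<^sub>v u)"
      if X: "X \<in> carrier_mat k n" for X k
    proof -
      have Xu: "X *\<^sub>v u \<in> carrier_vec k" using X u by auto
      have "u \<bullet> (transpose_mat X * X *\<^sub>v u) = u \<bullet> (transpose_mat X *\<^sub>v (X *\<^sub>v u))"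
        using X u by (subst assoc_mult_mat_vec[of _ n k]) auto
      also have "\<dots> = (transpose_mat X *\<^sub>v (X *\<^sub>v u)) \<bullet> u"
        using X u by (intro comm_scalar_prod[of _ n]) auto
      also have "\<dots> = (X *\<^sub>v u) \<bullet> (X *\<^sub>v u)"
        by (rule transpose_vec_mult_scalar[OF X u Xu])
      finally show ?thesis .
    qed
    from this[OF V] this[OF P] show ?thesis
      unfolding S_def using u V P
      by (simp add: add_mult_distrib_mat_vec[of _ n n] scalar_prod_add_distrib[of _ n])
  qed
  have nonneg: "(v :: real vec) \<bullet> v \<ge> 0" for v
    unfolding scalar_prod_self by (auto intro: sum_nonneg)
  \<comment> \<open>\<open>P\<close> is invertible, so the quadratic form of \<open>S\<close> is
    positive definite.\<close>
  have "det S \<noteq> 0"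
  proof
    assume "det S = 0"
    then obtain u where u: "u \<in> carrier_vec n" "u \<noteq> 0\<^sub>v n" "S *\<^sub>v u = 0\<^sub>v n"
      using det_0_iff_vec_prod_zero[OF S] by auto
    have "(P *\<^sub>v u) \<bullet> (P *\<^sub>v u) = 0"
      using form[OF u(1)] nonneg[of "P *\<^sub>v u"] nonneg[of "V *\<^sub>v u"] u by simp
    then have "P *\<^sub>v u = 0\<^sub>v n"
      using P u unfolding scalar_prod_self by (intro eq_vecI) (auto simp: sum_nonneg_eq_0_iff)
    with u detP0 det_0_iff_vec_prod_zero[OF P] show False by auto
  qed
  then have "det (D * transpose_mat D + U * transpose_mat U) = det S"
    unfolding S_def by (rule det_gram_complement[OF D U V P orth detD detP0])
  moreover have "c ^ n \<le> det S"
  proof (rule det_ge_of_quadratic_form_ge[OF S _ c(1)])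
    show "transpose_mat S = S"
      unfolding S_def using V P
      by (simp add: transpose_add[of _ n n] transpose_mult[of _ n _ _ n])
    fix u :: "real vec" assume u: "u \<in> carrier_vec n"
    show "c * (u \<bullet> u) \<le> u \<bullet> (S *\<^sub>v u)"
      using gram_vec_norm_ge[OF n A u, of lam bet] nonneg[of "P *\<^sub>v u"] form[OF u]
      unfolding c(2) V_def M_def by linarith
  qed
  ultimately show ?thesis
    unfolding B_mat_gram[OF A] D_def U_def M_def by simp
qed

section \<open>Passage from invertible shifts to arbitrary A\<close>

theorem proposition1:
  fixes n :: nat and lam bet :: "nat \<Rightarrow> real"
  assumes "n \<ge> 2"
    and "1 > lam 1"
    and "\<forall>i\<in>{1..<n}. lam i > lam (i + 1)"
    and "lam 1 > Max ((\<lambda>l. \<bar>lam l\<bar>) ` {2..n})"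
    and "(\<Sum>l=1..n. bet l) = 1"
    and "(\<Prod>l=1..n. bet l) \<noteq> 0"
  shows "\<forall>A \<in> carrier_mat n n.
    (\<forall>i<n. \<forall>j<n. A $$ (i, j) \<ge> 0) \<longrightarrow>
    (\<forall>i<n. (\<Sum>j<n. A $$ (i, j)) \<le> 1) \<longrightarrow>
    det (B_mat n lam bet A * transpose_mat (B_mat n lam bet A)) \<ge>
      2 powi (- (int n * (int n - 2))) *
      ((\<Sum>(i, j)\<in>idx_pairs n.
          gam n lam bet (n - 1) i * gam n lam bet (n - 1) j
            * (lam (cyc n (n + i - 1)) - lam (cyc n (n + j - 1)))\<^sup>2)
       / (\<Sum>i=1..n. gam n lam bet (n - 1) i)) ^ n"
proof (intro ballI impI)
  fix A :: "real mat" assume A: "A \<in> carrier_mat n n"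
  note n = \<open>n \<ge> 2\<close>
  let ?X = "(\<Sum>(i, j)\<in>idx_pairs n.
      gam n lam bet (n - 1) i * gam n lam bet (n - 1) j
        * (lam (cyc n (n + i - 1)) - lam (cyc n (n + j - 1)))\<^sup>2)
    / (\<Sum>i=1..n. gam n lam bet (n - 1) i)"
  define c where "c = (1 / 2) ^ (n - 2) * ?X"
  have c: "c \<ge> 0"
    unfolding c_def
    by (intro mult_nonneg_nonneg divide_nonneg_nonneg sum_nonneg) (auto intro!: mult_nonneg_nonneg gam_nonneg)
  have At: "A + t \<cdot>\<^sub>m 1\<^sub>m n \<in> carrier_mat n n" for t using A by simp
  \<comment> \<open>\<open>A\<close> is perturbed by \<open>t\<close> times the identity;
    \<open>c\<close> involves no entry of \<open>A\<close> and stays fixed.\<close>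
  define B where "B t = B_mat n lam bet (A + t \<cdot>\<^sub>m 1\<^sub>m n)" for t
  have B: "B t \<in> carrier_mat (n * n) (n * n + n)" for t
    unfolding B_def by (rule B_mat_carrier)
  have entry: "isCont (\<lambda>t. B t $$ (r, j)) 0" if r: "r < n * n" and j: "j < n * n + n" for r j
  proof -
    have "n > 0" using n by simp
    then show ?thesis
      unfolding B_def B_mat_index[OF At r j] using r j A
      by (cases "j < n * n"; cases "r div n = j div n") (auto simp: block_diag_def shift_mat_def)
  qed
  have "isCont (\<lambda>t. det (B t * transpose_mat (B t))) 0"
  proof (rule isCont_det)
    show "B t * transpose_mat (B t) \<in> carrier_mat (n * n) (n * n)" for t
      using B[of t] by (rule mult_carrier_mat) (simp add: B)
    fix r s assume rs: "r < n * n" "s < n * n"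
    have "(\<lambda>t. (B t * transpose_mat (B t)) $$ (r, s))
        = (\<lambda>t. \<Sum>j<n * n + n. B t $$ (r, j) * B t $$ (s, j))"
      using rs carrier_matD[OF B] by (simp add: scalar_prod_def lessThan_atLeast0)
    then show "isCont (\<lambda>t. (B t * transpose_mat (B t)) $$ (r, s)) 0"
      using rs by (auto intro!: continuous_intros entry)
  qed
  then have lim: "((\<lambda>t. det (B t * transpose_mat (B t))) \<longlongrightarrow> det (B 0 * transpose_mat (B 0))) (at 0)"
    by (simp add: isCont_def)
  \<comment> \<open>For small nonzero \<open>t\<close> none of the finitely many shifts is
    singular.\<close>
  have "eventually (\<lambda>t. \<forall>q\<in>{..<n}. det (A + t \<cdot>\<^sub>m 1\<^sub>m n - lam (q + 1) \<cdot>\<^sub>m 1\<^sub>m n) \<noteq> 0) (at 0)"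
    by (intro eventually_ball_finite ballI eventually_det_shift_nonzero[OF A]) auto
  then have "eventually (\<lambda>t. c ^ n \<le> det (B t * transpose_mat (B t))) (at 0)"
    by eventually_elim
      (unfold B_def, rule det_B_mat_gram_ge[OF n At _ c c_def], simp)
  then have "c ^ n \<le> det (B 0 * transpose_mat (B 0))"
    by (rule tendsto_lowerbound[OF lim]) simp
  moreover have "A + 0 \<cdot>\<^sub>m 1\<^sub>m n = A"
    using A by (intro eq_matI) auto
  moreover have "c ^ n = 2 powi (- (int n * (int n - 2))) * ?X ^ n"
  proof -
    \<comment> \<open>As \<open>n \<ge> 2\<close>, natural subtraction agrees with the integer one,
      so the exponent is the negative of the natural number \<open>n * (n - 2)\<close>.\<close>
    have "int n * (int n - 2) = int (n * (n - 2))" using n by simp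
    then show ?thesis
      unfolding c_def
      by (simp only: power_int_minus power_int_of_nat)
        (simp add: power_mult_distrib power_divide power_one_over power_mult[symmetric] mult.commute divide_simps)
  qed
  ultimately show "det (B_mat n lam bet A * transpose_mat (B_mat n lam bet A)) \<ge>
      2 powi (- (int n * (int n - 2))) * ?X ^ n"
    by (simp only: B_def)
qed

end
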